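(* Let $G$ be a finite group with $\lambda(G) \leqslant 6$. Then $G$ is supersolvable.
   Context: A covering of a finite group $G$ is a family of subgroups $X_1,\dots,X_n$ ($n\geq 2$) with $\bigcup_{i=1}^n X_i = G$. It is irredundant if $X_i \nsubseteq \bigcup_{j\neq i} X_j$ for every $i$. For a non-cyclic finite group $G$, $\lambda(G)$ denotes the maximum number of subgroups in an irredundant covering of $G$. For cyclic $G$ (which has no irredundant covering with $n\ge 2$) the convention is $\lambda(G)=1$. *)

theory Defs
  imports "HOL-Algebra.Algebra"
begin

text \<open>A covering of \<open>G\<close> is a family \<open>A 0, \<dots>, A (n - 1)\<close> of subgroups; the values \<open>A i\<close>
  with \<open>i \<ge> n\<close> are irrelevant.\<close>

definition covering :: "('a, 'b) monoid_scheme \<Rightarrow> nat \<Rightarrow> (nat \<Rightarrow> 'a set) \<Rightarrow> bool" where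
  "covering G n A \<longleftrightarrow> 2 \<le> n \<and> (\<forall>i<n. subgroup (A i) G) \<and> (\<Union>i<n. A i) = carrier G"

definition irredundant_covering :: "('a, 'b) monoid_scheme \<Rightarrow> nat \<Rightarrow> (nat \<Rightarrow> 'a set) \<Rightarrow> bool" where
  "irredundant_covering G n A \<longleftrightarrow>
     covering G n A \<and> (\<forall>i<n. \<not> A i \<subseteq> (\<Union>j\<in>{..<n} - {i}. A j))"

text \<open>The invariant \<open>\<lambda>(G)\<close>. For a finite non-cyclic group the set under \<^const>\<open>Max\<close> is finite and
  nonempty, as proved below.\<close>

definition max_irredundant :: "('a, 'b) monoid_scheme \<Rightarrow> nat" where
  "max_irredundant G =
     (if cyclic_group G then 1 else Max {n. \<exists>A. irredundant_covering G n A})"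

text \<open>All terms of the series are normal in the whole group \<open>G\<close>, not just in the next term.\<close>

definition supersolvable :: "('a, 'b) monoid_scheme \<Rightarrow> bool" where
  "supersolvable G \<longleftrightarrow>
     (\<exists>m N. N 0 = {\<one>\<^bsub>G\<^esub>} \<and> N m = carrier G \<and> (\<forall>i\<le>m. N i \<lhd> G) \<and>
        (\<forall>i<m. N i \<subseteq> N (Suc i) \<and>
           cyclic_group ((G\<lparr>carrier := N (Suc i)\<rparr>) Mod N i)))"

lemma irredundant_covering_le_card:
  assumes "finite (carrier G)" "irredundant_covering G n A"
  shows "n \<le> card (carrier G)"
proof -
  have "\<forall>i<n. \<exists>x. x \<in> A i \<and> (\<forall>j<n. j \<noteq> i \<longrightarrow> x \<notin> A j)"
    using assms(2) unfolding irredundant_covering_def by blast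
  then obtain f where f: "\<And>i. i < n \<Longrightarrow> f i \<in> A i"
    "\<And>i j. i < n \<Longrightarrow> j < n \<Longrightarrow> j \<noteq> i \<Longrightarrow> f i \<notin> A j"
    by metis
  have "inj_on f {..<n}"
    using f by (metis inj_onI lessThan_iff)
  moreover have "f ` {..<n} \<subseteq> carrier G"
    using assms(2) f(1) unfolding irredundant_covering_def covering_def by blast
  ultimately show ?thesis
    using card_inj_on_le[of f "{..<n}" "carrier G"] assms(1) by simp
qed

lemma finite_irredundant_coverings:
  assumes "finite (carrier G)"
  shows "finite {n. \<exists>A. irredundant_covering G n A}"
  by (rule finite_subset[of _ "{..card (carrier G)}"])
     (use irredundant_covering_le_card[OF assms] in auto)

lemma (in group) irredundant_covering_exists:
  assumes fin: "finite (carrier G)" and nc: "\<not> cyclic_group G"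
  shows "\<exists>n A. irredundant_covering G n A"
proof -
  define P where "P S \<longleftrightarrow> finite S \<and> (\<forall>H\<in>S. subgroup H G \<and> H \<noteq> carrier G) \<and> \<Union>S = carrier G"
    for S
  define C where "C = (\<lambda>x. generate G {x}) ` carrier G"
  have proper: "generate G {x} \<noteq> carrier G" if "x \<in> carrier G" for x
  proof
    assume "generate G {x} = carrier G"
    then have "subgroup_generated G {x} = G"
      using that by (simp add: subgroup_generated_def)
    then show False
      using nc that unfolding cyclic_group_def by blast
  qed
  have sub: "subgroup (generate G {x}) G" if "x \<in> carrier G" for x
    using generate_is_subgroup[of "{x}"] that by simp
  have "\<Union>C = carrier G"
    unfolding C_def using sub subgroup.subset generate.incl by fastforce
  then have "P C"
    unfolding P_def C_def using fin proper sub by auto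
  then obtain S where S: "P S" and min: "\<And>T. P T \<Longrightarrow> card S \<le> card T"
    using ex_has_least_nat[of P C card] by blast
  have finS: "finite S" using S P_def by blast
  obtain A where A: "bij_betw A {..<card S} S"
    using ex_bij_betw_nat_finite[OF finS] atLeast0LessThan by metis
  have img: "A ` {..<card S} = S" using A by (simp add: bij_betw_def)
  have irr: "\<not> H \<subseteq> \<Union>(S - {H})" if "H \<in> S" for H
  proof
    assume "H \<subseteq> \<Union>(S - {H})"
    then have "P (S - {H})" using S that unfolding P_def by blast
    then show False using min card_Diff1_less[OF finS that] by fastforce
  qed
  have "card S \<noteq> 0" using S finS one_closed unfolding P_def by auto
  moreover have "card S \<noteq> 1" using S unfolding P_def by (auto simp: card_1_singleton_iff)
  ultimately have "2 \<le> card S" by linarith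
  moreover have "\<not> A i \<subseteq> (\<Union>j\<in>{..<card S} - {i}. A j)" if "i < card S" for i
  proof -
    have inj: "inj_on A {..<card S}"
      using A by (simp add: bij_betw_def)
    have "A ` ({..<card S} - {i}) = A ` {..<card S} - A ` {i}"
      by (rule inj_on_image_set_diff[OF inj]) (use that in auto)
    then have "A ` ({..<card S} - {i}) = S - {A i}"
      using img by simp
    moreover have "A i \<in> S"
      using img that by blast
    ultimately show ?thesis
      using irr[of "A i"] by metis
  qed
  ultimately have "irredundant_covering G (card S) A"
    using S img unfolding irredundant_covering_def covering_def P_def by auto
  then show ?thesis by blast
qed

lemma (in group) cyclic_no_irredundant_covering:
  assumes "cyclic_group G"
  shows "\<not> irredundant_covering G n A"
proof
  assume irr: "irredundant_covering G n A"
  obtain x where x: "x \<in> carrier G" "subgroup_generated G {x} = G"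
    using assms unfolding cyclic_group_def by blast
  have gen: "generate G {x} = carrier G"
    using x carrier_subgroup_generated[of G "{x}"] by simp
  obtain i where i: "i < n" "x \<in> A i"
    using irr x(1) unfolding irredundant_covering_def covering_def by blast
  have "carrier G \<subseteq> A i"
    using generate_subgroup_incl[of "{x}" "A i"] gen i irr
    unfolding irredundant_covering_def covering_def by auto
  moreover obtain j where j: "j < n" "j \<noteq> i"
  proof -
    have "2 \<le> n" using irr unfolding irredundant_covering_def covering_def by blast
    then show ?thesis using that[of 0] that[of 1] by (cases "i = 0") auto
  qed
  moreover have "A j \<subseteq> carrier G"
    using irr j(1) unfolding irredundant_covering_def covering_def by blast
  ultimately show False
    using irr i(1) unfolding irredundant_covering_def by blast
qed

end

theory Submission
  imports Defs "HOL-Combinatorics.Permutations"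
begin

text \<open>For non-cyclic \<open>G\<close> the maximal cyclic subgroups form an irredundant covering, so there are at
  most six of them, and quotients of \<open>G\<close> are again covered by at most six cyclic subgroups. Hence it
  suffices to find a nontrivial normal cyclic subgroup in every nontrivial group with such a
  covering. If there is none, each conjugacy class of maximal cyclic subgroups has at least two
  members and these intersect trivially. A class of \<open>n\<close> subgroups of order \<open>c\<close> covers at most
  \<open>n (c - 1)\<close> nontrivial elements, where \<open>n c\<close> divides \<open>|G|\<close>. For \<open>n = 2\<close> the two members normalise
  each other, so even \<open>2 c\<^sup>2\<close> divides \<open>|G|\<close>; and if \<open>n c = |G|\<close>, then \<open>G\<close> acts faithfully on the class, so
  \<open>|G| \<le> n!\<close>. Counting elements excludes every partition of at most six into classes.\<close>

section \<open>Cyclic subgroups, maximal cyclic subgroups and conjugates\<close>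

definition cyclic_subgroups :: "('a, 'b) monoid_scheme \<Rightarrow> 'a set set" where
  "cyclic_subgroups G = (\<lambda>x. generate G {x}) ` carrier G"

definition maximal_cyclic :: "('a, 'b) monoid_scheme \<Rightarrow> 'a set set" where
  "maximal_cyclic G = {C \<in> cyclic_subgroups G. \<forall>D \<in> cyclic_subgroups G. C \<subseteq> D \<longrightarrow> C = D}"

definition conjugate :: "('a, 'b) monoid_scheme \<Rightarrow> 'a \<Rightarrow> 'a set \<Rightarrow> 'a set" where
  "conjugate G g H = (\<lambda>h. g \<otimes>\<^bsub>G\<^esub> h \<otimes>\<^bsub>G\<^esub> inv\<^bsub>G\<^esub> g) ` H"

definition conjugates :: "('a, 'b) monoid_scheme \<Rightarrow> 'a set \<Rightarrow> 'a set set" where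
  "conjugates G H = (\<lambda>g. conjugate G g H) ` carrier G"

lemma maximal_cyclic_subset: "maximal_cyclic G \<subseteq> cyclic_subgroups G"
  by (auto simp: maximal_cyclic_def)

lemma finite_cyclic_subgroups: "finite (carrier G) \<Longrightarrow> finite (cyclic_subgroups G)"
  by (simp add: cyclic_subgroups_def)

lemma finite_maximal_cyclic: "finite (carrier G) \<Longrightarrow> finite (maximal_cyclic G)"
  using maximal_cyclic_subset finite_cyclic_subgroups by (rule finite_subset)

context group
begin

lemma cyclic_subgroups_subgroup: "C \<in> cyclic_subgroups G \<Longrightarrow> subgroup C G"
  by (auto simp: cyclic_subgroups_def intro: generate_is_subgroup)

lemma ex_maximal_cyclic:
  assumes fin: "finite (carrier G)" and x: "x \<in> carrier G"
  shows "\<exists>C \<in> maximal_cyclic G. x \<in> C"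
proof -
  obtain C where C: "C \<in> cyclic_subgroups G" "generate G {x} \<subseteq> C"
    and "\<forall>D \<in> cyclic_subgroups G. C \<subseteq> D \<longrightarrow> C = D"
    using finite_has_maximal2[OF finite_cyclic_subgroups[OF fin], of "generate G {x}"] x
    unfolding cyclic_subgroups_def by blast
  then show ?thesis
    using generate.incl[of x "{x}" G] unfolding maximal_cyclic_def by blast
qed

text \<open>A generator of \<open>C\<close> lies in some member of \<open>S\<close>; that member
  contains all of \<open>C\<close>, so maximality makes the two equal. Hence a finite cyclic cover
  bounds the number of maximal cyclic subgroups.\<close>

lemma maximal_cyclic_subset_cover:
  assumes S: "S \<subseteq> cyclic_subgroups G" "\<Union>S = carrier G"
  shows "maximal_cyclic G \<subseteq> S"
proof
  fix C assume C: "C \<in> maximal_cyclic G"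
  then obtain x where x: "x \<in> carrier G" "C = generate G {x}"
    unfolding maximal_cyclic_def cyclic_subgroups_def by blast
  then obtain D where D: "D \<in> S" "x \<in> D" using S by blast
  have "C \<subseteq> D"
    using generate_subgroup_incl[of "{x}" D] D S cyclic_subgroups_subgroup x by blast
  then show "C \<in> S"
    using C D S unfolding maximal_cyclic_def by blast
qed

text \<open>Division with remainder by the least positive exponent \<open>k\<close> with
  \<open>x [^] k\<close> in \<open>H\<close>. This will make the intersection of a conjugacy class
  of cyclic subgroups cyclic.\<close>

lemma subgroup_of_cyclic:
  assumes fin: "finite (carrier G)" and C: "C \<in> cyclic_subgroups G"
    and H: "subgroup H G" "H \<subseteq> C"
  shows "H \<in> cyclic_subgroups G"
proof -
  obtain x where x: "x \<in> carrier G" and Cx: "C = generate G {x}"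
    using C unfolding cyclic_subgroups_def by blast
  have Cpow: "C = {x [^] k |k. k \<in> (UNIV :: nat set)}"
    unfolding Cx by (rule generate_pow_on_finite_carrier[OF fin x])
  define k where "k = (LEAST k :: nat. 0 < k \<and> x [^] k \<in> H)"
  have "\<exists>k :: nat. 0 < k \<and> x [^] k \<in> H"
    using ord_ge_1[OF fin x] pow_ord_eq_1[OF x] subgroup.one_closed[OF H(1)]
    by (intro exI[of _ "ord x"]) auto
  then have k: "0 < k" "x [^] k \<in> H"
    unfolding k_def by (metis (mono_tags, lifting) LeastI_ex)+
  have least: "l = 0" if "x [^] l \<in> H" "l < k" for l :: nat
    using that not_less_Least[of l "\<lambda>k. 0 < k \<and> x [^] k \<in> H"] unfolding k_def by auto
  have "H \<subseteq> generate G {x [^] k}"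
  proof
    fix h assume h: "h \<in> H"
    then obtain n :: nat where n: "h = x [^] n" using H Cpow by blast
    have pow: "(x [^] k) [^] m \<in> H" for m :: nat
      using k(2) H(1) by (induction m) (simp_all add: subgroup.m_closed subgroup.one_closed)
    have "h = (x [^] k) [^] (n div k) \<otimes> x [^] (n mod k)"
      using x by (simp add: n nat_pow_pow nat_pow_mult)
    then have "x [^] (n mod k) = inv ((x [^] k) [^] (n div k)) \<otimes> h"
      using x by (simp add: inv_solve_left)
    then have "x [^] (n mod k) \<in> H"
      using pow h H(1) by (simp add: subgroup.m_closed subgroup.m_inv_closed)
    then have "n mod k = 0"
      using least k(1) by simp
    then have "h = (x [^] k) [^] (n div k)"
      using x n by (auto simp: nat_pow_pow)
    then show "h \<in> generate G {x [^] k}"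
      using generate_pow_on_finite_carrier[OF fin, of "x [^] k"] x by auto
  qed
  then have "H = generate G {x [^] k}"
    using generate_subgroup_incl[of "{x [^] k}" H] k(2) H(1) by auto
  then show ?thesis
    using x unfolding cyclic_subgroups_def by auto
qed

section \<open>Conjugation, normalisers and orders of products\<close>

lemma conjugate_eq_coset: "conjugate G g H = g <# H #> inv g"
  by (auto simp: conjugate_def l_coset_def r_coset_def)

lemma conjugate_subset: "g \<in> carrier G \<Longrightarrow> H \<subseteq> carrier G \<Longrightarrow> conjugate G g H \<subseteq> carrier G"
  by (auto simp: conjugate_def)

lemma conjugate_conjugate:
  assumes "g \<in> carrier G" "h \<in> carrier G" "H \<subseteq> carrier G"
  shows "conjugate G g (conjugate G h H) = conjugate G (g \<otimes> h) H"
  unfolding conjugate_def image_image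
  using assms by (intro image_cong refl) (simp add: m_assoc inv_mult_group subset_iff)

lemma conjugate_one: "H \<subseteq> carrier G \<Longrightarrow> conjugate G \<one> H = H"
  unfolding conjugate_def by (subst image_cong[where g = "\<lambda>x. x"]) auto

lemma conjugate_inv_conjugate:
  assumes "g \<in> carrier G" "H \<subseteq> carrier G"
  shows "conjugate G (inv g) (conjugate G g H) = H" "conjugate G g (conjugate G (inv g) H) = H"
  using assms by (simp_all add: conjugate_conjugate conjugate_one)

lemma conjugate_mono: "H \<subseteq> K \<Longrightarrow> conjugate G g H \<subseteq> conjugate G g K"
  unfolding conjugate_def by blast

lemma card_conjugate:
  assumes "g \<in> carrier G" "H \<subseteq> carrier G"
  shows "card (conjugate G g H) = card H"
  unfolding conjugate_def
  by (rule card_image, rule inj_onI) (use assms in \<open>auto simp: subset_iff\<close>)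

lemma group_hom_conjugate: "g \<in> carrier G \<Longrightarrow> group_hom G G (\<lambda>h. g \<otimes> h \<otimes> inv g)"
  by unfold_locales (auto simp: hom_def m_assoc inv_solve_left)

lemma conjugate_generate:
  assumes "g \<in> carrier G" "x \<in> carrier G"
  shows "conjugate G g (generate G {x}) = generate G {g \<otimes> x \<otimes> inv g}"
  using group_hom.generate_img[OF group_hom_conjugate[OF assms(1)], of "{x}"] assms(2)
  by (simp add: conjugate_def)

lemma conjugate_cyclic_subgroups:
  assumes "g \<in> carrier G" "C \<in> cyclic_subgroups G"
  shows "conjugate G g C \<in> cyclic_subgroups G"
  using assms conjugate_generate unfolding cyclic_subgroups_def by auto

lemma conjugate_maximal_cyclic:
  assumes g: "g \<in> carrier G" and C: "C \<in> maximal_cyclic G"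
  shows "conjugate G g C \<in> maximal_cyclic G"
proof -
  have Cc: "C \<in> cyclic_subgroups G" using C by (simp add: maximal_cyclic_def)
  have Cs: "C \<subseteq> carrier G" by (rule subgroup.subset[OF cyclic_subgroups_subgroup[OF Cc]])
  have "conjugate G g C = D" if D: "D \<in> cyclic_subgroups G" and sub: "conjugate G g C \<subseteq> D" for D
  proof -
    have Ds: "D \<subseteq> carrier G" by (rule subgroup.subset[OF cyclic_subgroups_subgroup[OF D]])
    have "C \<subseteq> conjugate G (inv g) D"
      using conjugate_mono[OF sub, of "inv g"] conjugate_inv_conjugate(1)[OF g Cs] by simp
    then have "C = conjugate G (inv g) D"
      using C conjugate_cyclic_subgroups[OF inv_closed[OF g] D] unfolding maximal_cyclic_def by blast
    then show ?thesis
      using conjugate_inv_conjugate(2)[OF g Ds] by simp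
  qed
  then show ?thesis
    using conjugate_cyclic_subgroups[OF g Cc] unfolding maximal_cyclic_def by blast
qed

lemma conjugates_self: "H \<subseteq> carrier G \<Longrightarrow> H \<in> conjugates G H"
  unfolding conjugates_def using conjugate_one[of H] by (metis image_eqI one_closed)

lemma conjugates_closed:
  assumes "H \<subseteq> carrier G" "K \<in> conjugates G H" "g \<in> carrier G"
  shows "conjugate G g K \<in> conjugates G H"
  using assms unfolding conjugates_def by (auto simp: conjugate_conjugate)

lemma conjugates_eq:
  assumes H: "H \<subseteq> carrier G" and K: "K \<in> conjugates G H"
  shows "conjugates G K = conjugates G H"
proof -
  obtain g where g: "g \<in> carrier G" "K = conjugate G g H"
    using K unfolding conjugates_def by blast
  have "H = conjugate G (inv g) K" using g H conjugate_inv_conjugate by simp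
  then have "H \<in> conjugates G K" using g unfolding conjugates_def by blast
  moreover have "K \<subseteq> carrier G" using g H conjugate_subset by simp
  ultimately show ?thesis
    using conjugates_closed[OF H K] conjugates_closed[of K H] unfolding conjugates_def by blast
qed

text \<open>A common member would make both classes equal by \<open>conjugates_eq\<close>.
  Disjointness lets the sizes and element counts of different classes be added.\<close>

lemma conjugates_disjoint:
  assumes "H \<subseteq> carrier G" "K \<subseteq> carrier G" "K \<notin> conjugates G H"
  shows "conjugates G H \<inter> conjugates G K = {}"
  using assms conjugates_eq conjugates_self by (metis disjoint_iff)

lemma normalizer_eq:
  "H \<subseteq> carrier G \<Longrightarrow> normalizer G H = {g \<in> carrier G. conjugate G g H = H}"
  by (auto simp: normalizer_def stabilizer_def conjugate_eq_coset)

lemma card_conjugates_mult_normalizer: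
  assumes "H \<subseteq> carrier G"
  shows "card (conjugates G H) * card (normalizer G H) = order G"
proof -
  have "conjugates G H =
      orbit G (\<lambda>g. \<lambda>H \<in> {H. H \<subseteq> carrier G}. g <# H #> inv g) H"
    using assms by (auto simp: conjugates_def orbit_def conjugate_eq_coset)
  then show ?thesis
    using group_action.orbit_stabilizer_theorem[OF action_by_conjugation_on_power_set, of H] assms
    by (simp add: normalizer_def)
qed

lemma subgroup_subset_normalizer:
  assumes "subgroup H G"
  shows "H \<subseteq> normalizer G H"
  using subgroup.subset[OF normal_imp_subgroup[OF subgroup_in_normalizer[OF assms]]] by simp

lemma subgroup_in_subgroup_dvd:
  assumes "subgroup H G" "subgroup K G" "H \<subseteq> K"
  shows "card H dvd card K"
proof -
  interpret K: group "G\<lparr>carrier := K\<rparr>" using assms(2) by (rule subgroup_imp_group)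
  have "subgroup H (G\<lparr>carrier := K\<rparr>)" using assms subgroup_incl by blast
  from K.lagrange[OF this] show ?thesis by (simp add: order_def) (metis dvd_triv_right)
qed

lemma normal_iff_conjugate:
  assumes "subgroup H G"
  shows "H \<lhd> G \<longleftrightarrow> (\<forall>g \<in> carrier G. conjugate G g H \<subseteq> H)"
  using assms by (simp add: normal_inv_iff conjugate_def image_subset_iff)

text \<open>The product map on pairs is injective: \<open>h \<otimes> k = h' \<otimes> k'\<close>
  puts \<open>inv h' \<otimes> h = k' \<otimes> inv k\<close> into the intersection.\<close>

lemma card_mult_disjoint:
  assumes H: "subgroup H G" and K: "subgroup K G" and int: "H \<inter> K = {\<one>}"
  shows "card (H <#> K) = card H * card K"
proof -
  have "inj_on (\<lambda>(h, k). h \<otimes> k) (H \<times> K)"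
  proof (rule inj_onI, clarify)
    fix h k h' k'
    assume in': "h \<in> H" "k \<in> K" "h' \<in> H" "k' \<in> K" and eq: "h \<otimes> k = h' \<otimes> k'"
    have c: "h \<in> carrier G" "k \<in> carrier G" "h' \<in> carrier G" "k' \<in> carrier G"
      using in' subgroup.mem_carrier[OF H] subgroup.mem_carrier[OF K] by auto
    have e: "inv h' \<otimes> h = k' \<otimes> inv k"
    proof -
      have "inv h' \<otimes> h \<otimes> k = inv h' \<otimes> (h' \<otimes> k')" using c eq by (simp add: m_assoc)
      also have "\<dots> = k'" using c by (simp add: m_assoc[symmetric])
      finally show ?thesis using c by (simp add: inv_solve_right)
    qed
    moreover have "inv h' \<otimes> h \<in> H" "k' \<otimes> inv k \<in> K"
      using in' H K by (auto intro: subgroup.m_closed subgroup.m_inv_closed)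
    ultimately have "inv h' \<otimes> h = \<one>" "k' \<otimes> inv k = \<one>" using int by auto
    then have "h = h'"
      using c by (metis inv_closed inv_equality inv_inv)
    then show "h = h' \<and> k = k'"
      using c eq by simp
  qed
  moreover have "H <#> K = (\<lambda>(h, k). h \<otimes> k) ` (H \<times> K)"
    by (auto simp: set_mult_def)
  ultimately show ?thesis by (simp add: card_image card_cartesian_product)
qed

end

subsection \<open>Groups without nontrivial normal cyclic subgroups\<close>

text \<open>Set up for a contradiction with a small cyclic cover. Without such a cover it has
  instances, such as the alternating group on four letters.\<close>

locale no_normal_cyclic = group +
  assumes fin: "finite (carrier G)"
    and nontrivial: "carrier G \<noteq> {\<one>}"
    and no_normal: "\<lbrakk>C \<in> cyclic_subgroups G; C \<lhd> G\<rbrakk> \<Longrightarrow> C = {\<one>}"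
begin

lemma maximal_cyclic_subgroup: "C \<in> maximal_cyclic G \<Longrightarrow> subgroup C G"
  using cyclic_subgroups_subgroup maximal_cyclic_subset by blast

lemma maximal_cyclic_carrier: "C \<in> maximal_cyclic G \<Longrightarrow> C \<subseteq> carrier G"
  using maximal_cyclic_subgroup subgroup.subset by blast

lemma maximal_cyclic_neq_one:
  assumes "C \<in> maximal_cyclic G" shows "C \<noteq> {\<one>}"
proof
  assume C: "C = {\<one>}"
  obtain x where x: "x \<in> carrier G" "x \<noteq> \<one>" using nontrivial one_closed by blast
  then have "C \<subseteq> generate G {x}" "generate G {x} \<in> cyclic_subgroups G"
    using C generate.one by (auto simp: cyclic_subgroups_def)
  then have "C = generate G {x}" using assms by (simp add: maximal_cyclic_def)
  then show False using C x generate.incl[of x "{x}" G] by blast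
qed

lemma card_maximal_cyclic_ge:
  assumes C: "C \<in> maximal_cyclic G" shows "2 \<le> card C"
proof -
  have "finite C" using finite_subset[OF maximal_cyclic_carrier[OF C] fin] .
  moreover have "\<one> \<in> C" using subgroup.one_closed[OF maximal_cyclic_subgroup[OF C]] .
  ultimately have "card C \<noteq> 0" "card C \<noteq> 1"
    using maximal_cyclic_neq_one[OF C] by (auto simp: card_1_singleton_iff)
  then show ?thesis by linarith
qed

lemma finite_conjugates: "finite (conjugates G H)"
  using fin by (simp add: conjugates_def)

lemma conjugates_maximal_cyclic: "C \<in> maximal_cyclic G \<Longrightarrow> conjugates G C \<subseteq> maximal_cyclic G"
  using conjugate_maximal_cyclic by (auto simp: conjugates_def)

text \<open>The only member of a one-element class would be a nontrivial normal cyclic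
  subgroup.\<close>

lemma card_conjugates_ge:
  assumes C: "C \<in> maximal_cyclic G" shows "2 \<le> card (conjugates G C)"
proof -
  have Cin: "C \<in> conjugates G C" by (rule conjugates_self[OF maximal_cyclic_carrier[OF C]])
  have "card (conjugates G C) \<noteq> 1"
  proof
    assume "card (conjugates G C) = 1"
    then have "conjugates G C = {C}" using Cin by (auto simp: card_1_singleton_iff)
    then have "\<forall>g \<in> carrier G. conjugate G g C \<subseteq> C" by (auto simp: conjugates_def)
    then have "C \<lhd> G" using normal_iff_conjugate[OF maximal_cyclic_subgroup[OF C]] by simp
    then show False
      using no_normal C maximal_cyclic_subset maximal_cyclic_neq_one[OF C] by blast
  qed
  moreover have "card (conjugates G C) \<noteq> 0" using Cin finite_conjugates by auto
  ultimately show ?thesis by linarith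
qed

text \<open>The intersection is cyclic as a subgroup of \<open>C\<close> and normal because
  conjugation permutes the class, so \<open>no_normal\<close> applies.\<close>

lemma Inter_conjugates:
  assumes C: "C \<in> maximal_cyclic G" shows "\<Inter>(conjugates G C) = {\<one>}"
proof (rule no_normal)
  let ?I = "\<Inter>(conjugates G C)"
  have Cc: "C \<subseteq> carrier G" by (rule maximal_cyclic_carrier[OF C])
  have Cin: "C \<in> conjugates G C" by (rule conjugates_self[OF Cc])
  have sub: "subgroup ?I G"
    using Cin conjugates_maximal_cyclic[OF C] maximal_cyclic_subgroup
    by (intro subgroups_Inter) blast+
  then show "?I \<in> cyclic_subgroups G"
    using subgroup_of_cyclic[OF fin, of C] C Cin maximal_cyclic_subset by blast
  have "conjugate G g ?I \<subseteq> K" if g: "g \<in> carrier G" and K: "K \<in> conjugates G C" for g K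
  proof -
    have "conjugate G (inv g) K \<in> conjugates G C"
      using conjugates_closed[OF Cc K] g by simp
    then have "conjugate G g ?I \<subseteq> conjugate G g (conjugate G (inv g) K)"
      by (intro conjugate_mono) blast
    also have "\<dots> = K"
      using K conjugates_maximal_cyclic[OF C] maximal_cyclic_carrier
      by (intro conjugate_inv_conjugate(2)[OF g]) blast
    finally show ?thesis .
  qed
  then show "?I \<lhd> G" using normal_iff_conjugate[OF sub] by blast
qed

section \<open>Restrictions imposed by a single conjugacy class\<close>

lemma card_dvd_card_normalizer:
  assumes C: "C \<in> maximal_cyclic G" shows "card C dvd card (normalizer G C)"
  using subgroup_in_subgroup_dvd[OF maximal_cyclic_subgroup[OF C] normalizer_imp_subgroup
      subgroup_subset_normalizer[OF maximal_cyclic_subgroup[OF C]]] maximal_cyclic_carrier[OF C]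
  by blast

text \<open>Under this hypothesis every conjugate is its own normaliser, so the kernel of the action on the
  class is the intersection of the class.\<close>

lemma order_le_fact:
  assumes C: "C \<in> maximal_cyclic G" and self: "card C = card (normalizer G C)"
  shows "order G \<le> fact (card (conjugates G C))"
proof -
  let ?S = "conjugates G C"
  \<comment> \<open>Conjugation on the class, extended by the identity outside it as
    \<open>permutes\<close> requires.\<close>
  define p where "p g = (\<lambda>K. if K \<in> ?S then conjugate G g K else K)" for g
  have Cc: "C \<subseteq> carrier G" by (rule maximal_cyclic_carrier[OF C])
  have SM: "K \<in> maximal_cyclic G" "K \<subseteq> carrier G" if "K \<in> ?S" for K
    using that conjugates_maximal_cyclic[OF C] maximal_cyclic_carrier by blast+
  have norm: "normalizer G K = K" if K: "K \<in> ?S" for K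
  proof -
    have "card K = card C"
      using K card_conjugate[OF _ Cc] by (auto simp: conjugates_def)
    moreover have "card ?S * card (normalizer G K) = card ?S * card (normalizer G C)"
      using card_conjugates_mult_normalizer[OF Cc] card_conjugates_mult_normalizer[OF SM(2)[OF K]]
        conjugates_eq[OF Cc K] by simp
    ultimately have "card K = card (normalizer G K)"
      using self card_conjugates_ge[OF C] by simp
    moreover have "finite (normalizer G K)"
      using finite_subset[OF subgroup.subset[OF normalizer_imp_subgroup[OF SM(2)[OF K]]] fin] .
    ultimately show ?thesis
      using subgroup_subset_normalizer[OF maximal_cyclic_subgroup[OF SM(1)[OF K]]]
        card_subset_eq by metis
  qed
  have "p g permutes ?S" if g: "g \<in> carrier G" for g
  proof (rule bij_imp_permutes)
    have "inj_on (p g) ?S"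
      using conjugate_inv_conjugate(1)[OF g] SM(2)
      unfolding p_def by (intro inj_onI) (metis (full_types))
    moreover have "p g ` ?S \<subseteq> ?S"
      using conjugates_closed[OF Cc _ g] by (auto simp: p_def)
    ultimately show "bij_betw (p g) ?S ?S"
      using endo_inj_surj[OF finite_conjugates] by (simp add: bij_betw_def)
  qed (simp add: p_def)
  then have "p ` carrier G \<subseteq> {q. q permutes ?S}" by blast
  moreover have "inj_on p (carrier G)"
  proof (rule inj_onI)
    fix g h assume g: "g \<in> carrier G" and h: "h \<in> carrier G" and eq: "p g = p h"
    \<comment> \<open>Elements acting alike differ by one that normalises, hence belongs to, each
      \<open>K\<close>.\<close>
    have "inv h \<otimes> g \<in> K" if K: "K \<in> ?S" for K
    proof -
      have "conjugate G g K = conjugate G h K"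
        using fun_cong[OF eq, of K] K by (simp add: p_def)
      then have "conjugate G (inv h) (conjugate G g K) = K"
        using conjugate_inv_conjugate(1)[OF h SM(2)[OF K]] by simp
      then have "inv h \<otimes> g \<in> normalizer G K"
        using conjugate_conjugate[of "inv h" g K] SM(2)[OF K] g h by (simp add: normalizer_eq)
      then show ?thesis by (simp add: norm[OF K])
    qed
    then have "inv h \<otimes> g \<in> \<Inter>?S" by blast
    then have "inv h \<otimes> g = \<one>" using Inter_conjugates[OF C] by simp
    then show "g = h" using g h by (metis inv_closed inv_equality inv_inv)
  qed
  ultimately have "card (carrier G) \<le> card {q. q permutes ?S}"
    using card_inj_on_le finite_permutations[OF finite_conjugates] by metis
  then show ?thesis
    using card_permutations[OF refl finite_conjugates] by (simp add: order_def)
qed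

text \<open>In a class with two members, whatever fixes \<open>D\<close> also fixes
  \<open>C\<close>. So \<open>D\<close> lies in the normaliser of \<open>C\<close>, where
  \<open>C\<close> is normal and \<open>C <#> D\<close> is a subgroup; as \<open>C\<close> and
  \<open>D\<close> meet trivially, its order is \<open>card C * card C\<close>.\<close>

lemma card_square_dvd_normalizer:
  assumes C: "C \<in> maximal_cyclic G" and two: "card (conjugates G C) = 2"
  shows "card C * card C dvd card (normalizer G C)"
proof -
  have Cc: "C \<subseteq> carrier G" by (rule maximal_cyclic_carrier[OF C])
  have Cin: "C \<in> conjugates G C" by (rule conjugates_self[OF Cc])
  then obtain D where D: "conjugates G C = {C, D}" "C \<noteq> D"
    using two unfolding card_2_iff by (metis insert_commute insert_iff singletonD)
  then obtain h where h: "h \<in> carrier G" "D = conjugate G h C"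
    unfolding conjugates_def by blast
  have DM: "D \<in> maximal_cyclic G" using D conjugates_maximal_cyclic[OF C] by blast
  have Dc: "D \<subseteq> carrier G" by (rule maximal_cyclic_carrier[OF DM])
  have stays: "conjugate G g C = C" if g: "g \<in> carrier G" and "conjugate G g D = D" for g
  proof -
    have "conjugate G g C \<noteq> D"
      using that D(2) conjugate_inv_conjugate(1)[OF g Cc] conjugate_inv_conjugate(1)[OF g Dc] by metis
    then show ?thesis using conjugates_closed[OF Cc Cin g] D(1) by blast
  qed
  have "D \<subseteq> normalizer G C"
  proof
    fix g assume g: "g \<in> D"
    then have "g \<in> carrier G" "conjugate G g D = D"
      using subgroup_subset_normalizer[OF maximal_cyclic_subgroup[OF DM]] normalizer_eq[OF Dc] by auto
    then show "g \<in> normalizer G C" using stays[of g] normalizer_eq[OF Cc] by simp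
  qed
  have subN: "subgroup (normalizer G C) G" by (rule normalizer_imp_subgroup[OF Cc])
  interpret N: group "G\<lparr>carrier := normalizer G C\<rparr>" by (rule subgroup_imp_group[OF subN])
  interpret CD: second_isomorphism_grp C "G\<lparr>carrier := normalizer G C\<rparr>" D
    unfolding second_isomorphism_grp_def second_isomorphism_grp_axioms_def
    using subgroup_in_normalizer[OF maximal_cyclic_subgroup[OF C]]
      subgroup_incl[OF maximal_cyclic_subgroup[OF DM] subN \<open>D \<subseteq> normalizer G C\<close>] by blast
  have "subgroup (C <#> D) (G\<lparr>carrier := normalizer G C\<rparr>)"
    using CD.normal_set_mult_subgroup by simp
  then have "card (C <#> D) dvd card (normalizer G C)"
    using N.lagrange by (simp add: order_def) (metis dvd_triv_right)
  moreover have "C \<inter> D = {\<one>}"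
    using Inter_conjugates[OF C] D by simp
  moreover have "card D = card C" using card_conjugate h Cc by simp
  ultimately show ?thesis
    using card_mult_disjoint[OF maximal_cyclic_subgroup[OF C] maximal_cyclic_subgroup[OF DM]] by simp
qed

section \<open>Counting elements\<close>

lemma order_le_sum: "order G \<le> 1 + (\<Sum>C\<in>maximal_cyclic G. card C - 1)"
proof -
  have finM: "finite (maximal_cyclic G)" by (rule finite_maximal_cyclic[OF fin])
  \<comment> \<open>The identity is counted once for all; overlaps elsewhere only make the union
    smaller than the sum.\<close>
  have "carrier G \<subseteq> insert \<one> (\<Union>C\<in>maximal_cyclic G. C - {\<one>})"
    using ex_maximal_cyclic[OF fin] by blast
  moreover have "finite (\<Union>C\<in>maximal_cyclic G. C - {\<one>})"
    using finM finite_subset[OF maximal_cyclic_carrier fin] by (intro finite_UN_I) auto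
  ultimately have "order G \<le> card ({\<one>} \<union> (\<Union>C\<in>maximal_cyclic G. C - {\<one>}))"
    unfolding order_def by (intro card_mono) auto
  also have "\<dots> \<le> 1 + card (\<Union>C\<in>maximal_cyclic G. C - {\<one>})"
    using card_Un_le[of "{\<one>}" "\<Union>C\<in>maximal_cyclic G. C - {\<one>}"] by simp
  also have "card (\<Union>C\<in>maximal_cyclic G. C - {\<one>}) \<le> (\<Sum>C\<in>maximal_cyclic G. card (C - {\<one>}))"
    by (rule card_UN_le[OF finM])
  also have "(\<Sum>C\<in>maximal_cyclic G. card (C - {\<one>})) = (\<Sum>C\<in>maximal_cyclic G. card C - 1)"
    by (rule sum.cong[OF refl]) (rule card_Diff_singleton[OF subgroup.one_closed[OF maximal_cyclic_subgroup]])
  finally show ?thesis by simp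
qed

lemma sum_conjugates:
  assumes "C \<in> maximal_cyclic G"
  shows "(\<Sum>D\<in>conjugates G C. card D - 1) = card (conjugates G C) * (card C - 1)"
proof -
  have "card D = card C" if "D \<in> conjugates G C" for D
    using that card_conjugate[OF _ maximal_cyclic_carrier[OF assms]] by (auto simp: conjugates_def)
  then show ?thesis by simp
qed

text \<open>Chosen generators are distinct and nontrivial. The bound is what finally excludes two
  classes of size three, where the factorial gives order at most six.\<close>

lemma card_maximal_cyclic_less: "card (maximal_cyclic G) < order G"
proof -
  have "\<forall>C \<in> maximal_cyclic G. \<exists>x \<in> carrier G. generate G {x} = C"
    by (auto simp: maximal_cyclic_def cyclic_subgroups_def)
  then obtain f where f: "\<And>C. C \<in> maximal_cyclic G \<Longrightarrow> f C \<in> carrier G"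
    "\<And>C. C \<in> maximal_cyclic G \<Longrightarrow> generate G {f C} = C" by metis
  have "inj_on f (maximal_cyclic G)" by (rule inj_on_inverseI[of _ "\<lambda>x. generate G {x}"]) (rule f(2))
  moreover have "f C \<noteq> \<one>" if "C \<in> maximal_cyclic G" for C
    using f(2)[OF that] maximal_cyclic_neq_one[OF that] generate_one by auto
  then have "f ` maximal_cyclic G \<subseteq> carrier G - {\<one>}" using f(1) by auto
  ultimately have "card (maximal_cyclic G) \<le> card (carrier G - {\<one>})"
    using fin by (intro card_inj_on_le) auto
  also have "\<dots> < card (carrier G)" using fin by (intro card_Diff1_less) auto
  finally show ?thesis by (simp add: order_def)
qed

end

section \<open>Numerical exclusion of small class patterns\<close>

text \<open>\<open>g\<close> is the group order; \<open>n\<close>, \<open>k\<close> and \<open>c\<close> are the number of conjugates, the order of the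
  normaliser and the order of a maximal cyclic subgroup.\<close>

definition orbit_data :: "nat \<Rightarrow> nat \<Rightarrow> nat \<Rightarrow> nat \<Rightarrow> bool" where
  "orbit_data g n k c \<longleftrightarrow> n * k = g \<and> c dvd k \<and> 2 \<le> c \<and> 2 \<le> n \<and>
     (n = 2 \<longrightarrow> c * c dvd k) \<and> (c = k \<longrightarrow> g \<le> fact n)"

lemma orbit_data_half:
  assumes "orbit_data g n k c" "0 < g" "c \<noteq> k"
  shows "2 * c \<le> k"
proof -
  obtain q where q: "k = c * q" using assms(1) by (auto simp: orbit_data_def)
  have "q \<noteq> 0" "q \<noteq> 1" using assms q by (auto simp: orbit_data_def)
  then have "2 \<le> q" by linarith
  then have "c * 2 \<le> c * q" by (rule mult_le_mono2)
  then show ?thesis by (simp add: q mult.commute)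
qed

text \<open>The third inequality is \<open>(c - 1) * (c - 2) \<ge> 0\<close>. With
  \<open>c * c\<close> as an atom all four facts are linear, which suits the arithmetic in the cases
  below.\<close>

lemma orbit_data_two:
  assumes "orbit_data g 2 k c" "0 < g"
  shows "g = 2 * k" "c * c \<le> k" "3 * c \<le> c * c + 2" "2 * c \<le> k"
proof -
  show g: "g = 2 * k" using assms by (simp add: orbit_data_def)
  have c: "2 \<le> c" using assms by (simp add: orbit_data_def)
  have "c * c dvd k" using assms by (simp add: orbit_data_def)
  then show sq: "c * c \<le> k" using g assms by (auto intro: dvd_imp_le)
  show "2 * c \<le> k" using mult_le_mono1[OF c, of c] sq by linarith
  obtain d where "c = 2 + d" using c le_Suc_ex by blast
  then show "3 * c \<le> c * c + 2" by (simp add: algebra_simps)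
qed

text \<open>Since \<open>c \<le> k\<close>, the order is at least \<open>n * c\<close>, while the
  assumed bound is \<open>n * c - (n - 1)\<close>.\<close>

lemma one_orbit_impossible:
  assumes "orbit_data g n k c" "0 < g" "g \<le> 1 + n * (c - 1)"
  shows False
proof -
  have data: "n * k = g" "c dvd k" "2 \<le> c" "2 \<le> n" using assms(1) by (auto simp: orbit_data_def)
  have "0 < k" using data(1) assms(2) by (cases k) auto
  then have "n * c \<le> n * k" using data(2) by (intro mult_le_mono2 dvd_imp_le)
  moreover obtain d where "c = Suc d" using data(3) by (cases c) auto
  ultimately show False using assms(3) data by simp
qed

text \<open>If \<open>2 * c \<le> k\<close> for both classes, each \<open>n * c\<close> is at most
  half of \<open>g\<close> and the bound drops to \<open>g + 1 - n1 - n2\<close>. Size two always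
  satisfies this, so what remains is a class of size three or four with \<open>c = k\<close>, where
  the factorial bounds \<open>g\<close>.\<close>

lemma two_orbits_impossible:
  assumes o1: "orbit_data g n1 k1 c1" and o2: "orbit_data g n2 k2 c2"
    and le: "n1 \<le> n2" "n1 + n2 \<le> 6" "n1 + n2 < g"
    and g: "g \<le> 1 + n1 * (c1 - 1) + n2 * (c2 - 1)"
  shows False
proof -
  have g0: "0 < g" using le by linarith
  have c: "2 \<le> c1" "2 \<le> c2" "n1 * k1 = g" "n2 * k2 = g" "2 \<le> n1"
    using o1 o2 by (auto simp: orbit_data_def)
  consider "n1 = 2" "n2 = 2" | "n1 = 2" "n2 = 3" | "n1 = 2" "n2 = 4" | "n1 = 3" "n2 = 3"
    using le c by linarith
  then show False
  proof cases
    case 1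
    show False
      using orbit_data_two[OF o1[unfolded 1] g0] orbit_data_two[OF o2[unfolded 1] g0] g c 1 by simp
  next
    case 2
    note t = orbit_data_two[OF o1[unfolded 2] g0]
    show False
    proof (cases "c2 = k2")
      case True
      then have "g \<le> 6" using o2 2 by (simp add: orbit_data_def fact_numeral)
      then show False using t mult_le_mono[OF c(1) c(1)] by linarith
    next
      case False
      then show False using orbit_data_half[OF o2 g0] t g c 2 by simp
    qed
  next
    case 3
    note t = orbit_data_two[OF o1[unfolded 3] g0]
    show False
    proof (cases "c2 = k2")
      case True
      then have g24: "g \<le> 24" using o2 3 by (simp add: orbit_data_def fact_numeral)
      \<comment> \<open>Now \<open>4 * c2 = g\<close>, so the bound leaves
        \<open>5 \<le> 2 * c1\<close>, while \<open>2 * c1 * c1 \<le> 24\<close>. Thus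
        \<open>c1 = 3\<close>, which forces \<open>k1 = 9\<close>, yet \<open>k1 = 2 * k2\<close> is
        even.\<close>
      have "3 \<le> c1" using g t c 3 True by simp
      moreover have "c1 < 4"
      proof (rule ccontr)
        assume "\<not> c1 < 4"
        then have "4 * 4 \<le> c1 * c1" by (intro mult_le_mono) auto
        then show False using g24 t by linarith
      qed
      ultimately have "c1 = 3" by linarith
      then have "9 dvd k1" using o1 3 by (simp add: orbit_data_def)
      moreover have "k1 \<le> 12" "0 < k1" "k1 = 2 * k2" using g24 t c 3 g0 by simp_all
      ultimately show False by presburger
    next
      case False
      then show False using orbit_data_half[OF o2 g0] t g c 3 by simp
    qed
  next
    case 4
    have "k1 \<le> c1 + c2 - 2" "k1 = k2" using g c 4 by simp_all
    \<comment> \<open>Otherwise \<open>c1 + c2\<close> would be at most \<open>k1\<close>. The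
      resulting \<open>g \<le> 6\<close> contradicts \<open>n1 + n2 < g\<close>.\<close>
    then have "c1 = k1 \<or> c2 = k2"
      using orbit_data_half[OF o1 g0] orbit_data_half[OF o2 g0] c by linarith
    then have "g \<le> 6" using o1 o2 4 by (auto simp: orbit_data_def fact_numeral)
    then show False using le 4 by simp
  qed
qed

text \<open>From \<open>3 * c \<le> c * c + 2 \<le> k + 2\<close> and \<open>g = 2 * k\<close> for
  each class, twice the sum of the three \<open>c\<close> is at most \<open>g + 4\<close>, whereas
  the assumed bound makes it at least \<open>g + 5\<close>.\<close>

lemma three_orbits_impossible:
  assumes "orbit_data g 2 k1 c1" "orbit_data g 2 k2 c2" "orbit_data g 2 k3 c3"
    and "0 < g" and "g \<le> 1 + 2 * (c1 - 1) + 2 * (c2 - 1) + 2 * (c3 - 1)"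
  shows False
proof -
  have "2 \<le> c1" "2 \<le> c2" "2 \<le> c3" using assms by (auto simp: orbit_data_def)
  then show False
    using assms(5) orbit_data_two[OF assms(1,4)] orbit_data_two[OF assms(2,4)]
      orbit_data_two[OF assms(3,4)] by linarith
qed

section \<open>Assembling the class patterns\<close>

context no_normal_cyclic
begin

lemma orbit_data_maximal_cyclic:
  assumes "C \<in> maximal_cyclic G"
  shows "orbit_data (order G) (card (conjugates G C)) (card (normalizer G C)) (card C)"
  unfolding orbit_data_def
  using card_conjugates_mult_normalizer[OF maximal_cyclic_carrier] card_dvd_card_normalizer
    card_maximal_cyclic_ge card_conjugates_ge card_square_dvd_normalizer order_le_fact assms
  by blast

text \<open>Classes are split off one at a time. Each has at least two members, so at most three fit
  into six, and three only with two members each. The alternating group on four letters has seven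
  maximal cyclic subgroups, so the constant cannot be raised.\<close>

lemma card_maximal_cyclic_gt: "6 < card (maximal_cyclic G)"
proof (rule ccontr)
  let ?M = "maximal_cyclic G" and ?O = "conjugates G" and ?n = "\<lambda>C. card (conjugates G C)"
  assume "\<not> 6 < card ?M"
  then have six: "card ?M \<le> 6" by simp
  have finM: "finite ?M" by (rule finite_maximal_cyclic[OF fin])
  have g0: "0 < order G" using card_maximal_cyclic_less by linarith
  note data = orbit_data_maximal_cyclic
  note OM = conjugates_maximal_cyclic
  have disj: "?O C \<inter> ?O D = {}" if "C \<in> ?M" "D \<in> ?M" "D \<notin> ?O C" for C D
    using conjugates_disjoint maximal_cyclic_carrier that by blast
  obtain A where A: "A \<in> ?M" using ex_maximal_cyclic[OF fin one_closed] by blast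
  have "?M \<noteq> ?O A"
  proof
    assume "?M = ?O A"
    then show False
      using one_orbit_impossible[OF data[OF A] g0] order_le_sum sum_conjugates[OF A] by simp
  qed
  then obtain B where B: "B \<in> ?M" "B \<notin> ?O A" using OM[OF A] by blast
  note AB = disj[OF A B]
  have cardAB: "card (?O A \<union> ?O B) = ?n A + ?n B"
    using AB finite_conjugates by (simp add: card_Un_disjoint)
  have subAB: "?O A \<union> ?O B \<subseteq> ?M" using OM A B by blast
  have sumAB: "(\<Sum>D\<in>?O A \<union> ?O B. card D - 1) = ?n A * (card A - 1) + ?n B * (card B - 1)"
    using AB finite_conjugates sum_conjugates[OF A] sum_conjugates[OF B(1)]
    by (simp add: sum.union_disjoint)
  have "?M \<noteq> ?O A \<union> ?O B"
  proof
    assume M: "?M = ?O A \<union> ?O B"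
    have le: "?n A + ?n B \<le> 6" "?n A + ?n B < order G"
      using six card_maximal_cyclic_less cardAB M by simp_all
    have "order G \<le> 1 + ?n A * (card A - 1) + ?n B * (card B - 1)"
      using order_le_sum sumAB M by simp
    \<comment> \<open>Both orders of the classes are supplied because the numerical lemma expects
      the smaller one first.\<close>
    then show False
      using two_orbits_impossible[OF data[OF A] data[OF B(1)]]
        two_orbits_impossible[OF data[OF B(1)] data[OF A]] le by linarith
  qed
  then obtain C where C: "C \<in> ?M" "C \<notin> ?O A \<union> ?O B" using subAB by blast
  have ABC: "(?O A \<union> ?O B) \<inter> ?O C = {}"
    using disj[OF A C(1)] disj[OF B(1) C(1)] C(2) by blast
  have cardABC: "card (?O A \<union> ?O B \<union> ?O C) = ?n A + ?n B + ?n C"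
    using ABC cardAB finite_conjugates by (simp add: card_Un_disjoint)
  have subABC: "?O A \<union> ?O B \<union> ?O C \<subseteq> ?M" using OM subAB C(1) by blast
  have "?n A + ?n B + ?n C \<le> 6"
    using card_mono[OF finM subABC] cardABC six by linarith
  then have n: "?n A = 2" "?n B = 2" "?n C = 2"
    using card_conjugates_ge[OF A] card_conjugates_ge[OF B(1)] card_conjugates_ge[OF C(1)]
    by linarith+
  then have M: "?M = ?O A \<union> ?O B \<union> ?O C"
    using card_seteq[OF finM subABC] cardABC six by simp
  have "(\<Sum>D\<in>?M. card D - 1)
      = ?n A * (card A - 1) + ?n B * (card B - 1) + ?n C * (card C - 1)"
    unfolding M using ABC sumAB sum_conjugates[OF C(1)] finite_conjugates
    by (simp add: sum.union_disjoint)
  then show False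
    using three_orbits_impossible[OF data[OF A, unfolded n] data[OF B(1), unfolded n]
        data[OF C(1), unfolded n] g0] order_le_sum n by simp
qed

end

text \<open>Formulated for any cyclic cover, not for irredundant coverings, because the image of a
  cyclic cover in a quotient is again one.\<close>

lemma (in group) ex_normal_cyclic_subgroup:
  assumes "finite (carrier G)" "carrier G \<noteq> {\<one>}"
    and S: "S \<subseteq> cyclic_subgroups G" "\<Union>S = carrier G" "finite S" "card S \<le> 6"
  shows "\<exists>C \<in> cyclic_subgroups G. C \<lhd> G \<and> C \<noteq> {\<one>}"
proof (rule ccontr)
  assume "\<not> ?thesis"
  then interpret no_normal_cyclic G using assms by unfold_locales auto
  show False
    using card_maximal_cyclic_gt card_mono[OF S(3) maximal_cyclic_subset_cover[OF S(1,2)]] S(4)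
    by linarith
qed

subsection \<open>From coverings to supersolvability\<close>

lemma (in group) cyclic_group_iff: "cyclic_group G \<longleftrightarrow> carrier G \<in> cyclic_subgroups G"
proof
  assume "cyclic_group G"
  then obtain x where "x \<in> carrier G" "subgroup_generated G {x} = G"
    unfolding cyclic_group_def by blast
  then show "carrier G \<in> cyclic_subgroups G"
    using carrier_subgroup_generated[of G "{x}"] by (auto simp: cyclic_subgroups_def)
next
  assume "carrier G \<in> cyclic_subgroups G"
  then obtain x where x: "x \<in> carrier G" "generate G {x} = carrier G"
    by (auto simp: cyclic_subgroups_def)
  then have "subgroup_generated G {x} = G"
    by (simp add: subgroup_generated_def)
  then show "cyclic_group G"
    using x unfolding cyclic_group_def by blast
qed

lemma (in group) Union_maximal_cyclic:
  assumes "finite (carrier G)" shows "\<Union>(maximal_cyclic G) = carrier G"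
proof
  show "\<Union>(maximal_cyclic G) \<subseteq> carrier G"
    using subgroup.subset[OF cyclic_subgroups_subgroup] maximal_cyclic_subset[of G] by blast
  show "carrier G \<subseteq> \<Union>(maximal_cyclic G)"
    using ex_maximal_cyclic[OF assms] by blast
qed

text \<open>A generator of one maximal cyclic subgroup lies in no other, since inclusion and then
  equality would follow. Hence \<open>max_irredundant\<close> bounds the number of these
  subgroups.\<close>

lemma (in group) irredundant_covering_maximal_cyclic:
  assumes fin: "finite (carrier G)" and nc: "\<not> cyclic_group G"
  shows "\<exists>A. irredundant_covering G (card (maximal_cyclic G)) A"
proof -
  let ?M = "maximal_cyclic G"
  have finM: "finite ?M" by (rule finite_maximal_cyclic[OF fin])
  obtain A where A: "bij_betw A {..<card ?M} ?M"
    using ex_bij_betw_nat_finite[OF finM] atLeast0LessThan by metis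
  have img: "A ` {..<card ?M} = ?M" and inj: "inj_on A {..<card ?M}"
    using A by (simp_all add: bij_betw_def)
  have Un: "\<Union>?M = carrier G" by (rule Union_maximal_cyclic[OF fin])
  have "card ?M \<noteq> 0" using Un finM one_closed by auto
  moreover have "card ?M \<noteq> 1"
  proof
    assume "card ?M = 1"
    then obtain C where "?M = {C}" by (auto simp: card_1_singleton_iff)
    then have "carrier G = C" "C \<in> cyclic_subgroups G"
      using Un maximal_cyclic_subset[of G] by auto
    then show False using nc cyclic_group_iff by simp
  qed
  ultimately have "2 \<le> card ?M" by linarith
  moreover have "\<not> A i \<subseteq> (\<Union>j\<in>{..<card ?M} - {i}. A j)" if i: "i < card ?M" for i
  proof
    assume sub: "A i \<subseteq> (\<Union>j\<in>{..<card ?M} - {i}. A j)"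
    have Ai: "A i \<in> ?M" using img i by blast
    then obtain x where x: "x \<in> carrier G" "A i = generate G {x}"
      unfolding maximal_cyclic_def cyclic_subgroups_def by blast
    then have "x \<in> A i" using generate.incl[of x "{x}"] by simp
    then obtain j where j: "j < card ?M" "j \<noteq> i" "x \<in> A j" using sub by blast
    have Aj: "A j \<in> cyclic_subgroups G" using img j(1) maximal_cyclic_subset[of G] by blast
    then have "A i \<subseteq> A j"
      unfolding x(2) using generate_subgroup_incl[OF _ cyclic_subgroups_subgroup] j(3) by simp
    then have "A i = A j" using Ai Aj unfolding maximal_cyclic_def by blast
    then show False using inj_onD[OF inj] i j by auto
  qed
  moreover have "\<forall>i<card ?M. subgroup (A i) G"
    using bij_betwE[OF A] cyclic_subgroups_subgroup[OF subsetD[OF maximal_cyclic_subset]] by simp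
  moreover have "(\<Union>i<card ?M. A i) = carrier G" unfolding img by (rule Un)
  ultimately have "irredundant_covering G (card ?M) A"
    unfolding irredundant_covering_def covering_def by simp
  then show ?thesis by blast
qed

lemma (in group) ex_cyclic_cover:
  assumes fin: "finite (carrier G)" and le: "max_irredundant G \<le> 6"
  shows "\<exists>S \<subseteq> cyclic_subgroups G. \<Union>S = carrier G \<and> finite S \<and> card S \<le> 6"
proof (cases "cyclic_group G")
  \<comment> \<open>Here \<open>max_irredundant\<close> is 1 by convention, and the whole group
    serves as a one-member cover.\<close>
  case True
  then show ?thesis
    using cyclic_group_iff by (intro exI[of _ "{carrier G}"]) auto
next
  case False
  have "card (maximal_cyclic G) \<le> max_irredundant G"
    unfolding max_irredundant_def if_not_P[OF False]
    by (rule Max_ge[OF finite_irredundant_coverings[OF fin]])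
       (use irredundant_covering_maximal_cyclic[OF fin False] in simp)
  then show ?thesis
    using le Union_maximal_cyclic[OF fin] finite_maximal_cyclic[OF fin] maximal_cyclic_subset
    by (intro exI[of _ "maximal_cyclic G"]) auto
qed

section \<open>Quotients and normal cyclic extensions\<close>

lemma (in normal) group_hom_FactGroup: "group_hom G (G Mod H) (\<lambda>a. H #> a)"
  by (intro group_hom.intro group_hom_axioms.intro is_group factorgroup_is_group r_coset_hom_Mod)

text \<open>The image of \<open>generate G {x}\<close> is generated by the coset of
  \<open>x\<close>. As a set of images of members, the new cover is no larger than
  \<open>S\<close>.\<close>

lemma (in normal) cyclic_cover_FactGroup:
  assumes S: "S \<subseteq> cyclic_subgroups G" "\<Union>S = carrier G"
  shows "(`) (\<lambda>a. H #> a) ` S \<subseteq> cyclic_subgroups (G Mod H)"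
    and "\<Union>((`) (\<lambda>a. H #> a) ` S) = carrier (G Mod H)"
proof -
  interpret q: group_hom G "G Mod H" "\<lambda>a. H #> a" by (rule group_hom_FactGroup)
  show "(`) (\<lambda>a. H #> a) ` S \<subseteq> cyclic_subgroups (G Mod H)"
  proof
    fix Y assume "Y \<in> (`) (\<lambda>a. H #> a) ` S"
    then obtain x where x: "x \<in> carrier G" "Y = (\<lambda>a. H #> a) ` generate G {x}"
      using S(1) unfolding cyclic_subgroups_def by blast
    then have "Y = generate (G Mod H) {H #> x}"
      using q.generate_img[of "{x}"] by simp
    then show "Y \<in> cyclic_subgroups (G Mod H)"
      using x q.hom_closed unfolding cyclic_subgroups_def by blast
  qed
  show "\<Union>((`) (\<lambda>a. H #> a) ` S) = carrier (G Mod H)"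
    using S(2) by (auto simp: carrier_FactGroup)
qed

lemma (in normal) ex_normal_cyclic_extension:
  assumes fin: "finite (carrier G)" and proper: "H \<noteq> carrier G"
    and S: "S \<subseteq> cyclic_subgroups G" "\<Union>S = carrier G" "finite S" "card S \<le> 6"
  shows "\<exists>K. K \<lhd> G \<and> H \<subset> K \<and> cyclic_group ((G\<lparr>carrier := K\<rparr>) Mod H)"
proof -
  let ?F = "G Mod H"
  interpret q: group_hom G ?F "\<lambda>a. H #> a" by (rule group_hom_FactGroup)
  have finF: "finite (carrier ?F)" using fin by (simp add: carrier_FactGroup)
  have nt: "carrier ?F \<noteq> {\<one>\<^bsub>?F\<^esub>}"
  proof
    assume *: "carrier ?F = {\<one>\<^bsub>?F\<^esub>}"
    have "x \<in> H" if "x \<in> carrier G" for x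
      using q.hom_closed[OF that] * rcos_self[OF that is_subgroup] by simp
    then show False using proper subset by blast
  qed
  have "card ((`) (\<lambda>a. H #> a) ` S) \<le> 6" using card_image_le[OF S(3)] S(4) le_trans by blast
  then obtain Q where Q: "Q \<in> cyclic_subgroups ?F" "Q \<lhd> ?F" "Q \<noteq> {\<one>\<^bsub>?F\<^esub>}"
    using q.H.ex_normal_cyclic_subgroup[OF finF nt cyclic_cover_FactGroup[OF S(1,2)]] S(3) by blast
  obtain Y where Y: "Y \<in> carrier ?F" "Q = generate ?F {Y}"
    using Q(1) unfolding cyclic_subgroups_def by blast
  have Qsub: "subgroup Q ?F" by (rule normal_imp_subgroup[OF Q(2)])
  \<comment> \<open>The preimage of the nontrivial normal cyclic subgroup \<open>Q\<close> found in
    the quotient.\<close>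
  define K where "K = {a \<in> carrier G. H #> a \<in> Q}"
  have subK: "subgroup K G"
  proof (rule subgroupI)
    show "K \<noteq> {}" using subgroup.one_closed[OF Qsub] q.hom_one one_closed
      unfolding K_def by auto
  next
    fix a assume "a \<in> K"
    then show "inv a \<in> K"
      using subgroup.m_inv_closed[OF Qsub, of "H #> a"] q.hom_inv[of a] unfolding K_def by simp
  next
    fix a b assume "a \<in> K" "b \<in> K"
    then show "a \<otimes> b \<in> K"
      using subgroup.m_closed[OF Qsub, of "H #> a" "H #> b"] q.hom_mult[of a b]
      unfolding K_def by simp
  qed (auto simp: K_def)
  have "g \<otimes> a \<otimes> inv g \<in> K" if "g \<in> carrier G" "a \<in> K" for g a
  proof -
    have a: "a \<in> carrier G" "H #> a \<in> Q" using that(2) by (auto simp: K_def)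
    have "(H #> g) \<otimes>\<^bsub>?F\<^esub> (H #> a) \<otimes>\<^bsub>?F\<^esub> inv\<^bsub>?F\<^esub> (H #> g) \<in> Q"
      using Q(2) a(2) q.hom_closed[OF that(1)] unfolding q.H.normal_inv_iff by blast
    then have "H #> (g \<otimes> a \<otimes> inv g) \<in> Q"
      using that(1) a(1) by simp
    then show ?thesis using that(1) a(1) by (simp add: K_def)
  qed
  then have normK: "K \<lhd> G" using subK unfolding normal_inv_iff by blast
  have HK: "H \<subseteq> K"
    using subgroup.one_closed[OF Qsub] rcos_const[OF is_group] subset
    unfolding K_def one_FactGroup by auto
  have Qimg: "(\<lambda>a. H #> a) ` K = Q"
    using subgroup.subset[OF Qsub] unfolding K_def carrier_FactGroup by blast
  have "H \<in> Q" using subgroup.one_closed[OF Qsub] by simp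
  \<comment> \<open>A nontrivial coset in \<open>Q\<close> lifts to an element of \<open>K\<close>
    outside \<open>H\<close>, so the extension is strict.\<close>
  then obtain Z where Z: "Z \<in> Q" "Z \<noteq> H" using Q(3) unfolding one_FactGroup by blast
  then obtain a where a: "a \<in> K" "Z = H #> a" unfolding Qimg[symmetric] by blast
  have "a \<notin> H" using Z(2) rcos_const[OF is_group] unfolding a(2) by blast
  then have "H \<noteq> K" using a(1) by blast
  moreover
  \<comment> \<open>The structures are equal, not only isomorphic: the cosets of \<open>H\<close> in
    \<open>K\<close> form \<open>Q\<close>, and \<open>set_mult\<close> ignores the carrier.\<close>
  have "(G\<lparr>carrier := K\<rparr>) Mod H = subgroup_generated ?F {Y}"
  proof -
    have "rcosets\<^bsub>G\<lparr>carrier := K\<rparr>\<^esub> H = Q"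
      unfolding Qimg[symmetric] by (auto simp: RCOSETS_def r_coset_def)
    moreover have "set_mult (G\<lparr>carrier := K\<rparr>) = set_mult G"
      by (intro ext) (simp add: set_mult_def)
    ultimately show ?thesis using Y by (simp add: FactGroup_def subgroup_generated_def)
  qed
  then have "cyclic_group ((G\<lparr>carrier := K\<rparr>) Mod H)"
    using q.H.cyclic_group_generated[of Y] by simp
  ultimately show ?thesis
    using normK HK by blast
qed

section \<open>Building the normal series\<close>

lemma (in group) supersolvable_if_extensions:
  assumes fin: "finite (carrier G)"
    and ext: "\<And>H. H \<lhd> G \<Longrightarrow> H \<noteq> carrier G \<Longrightarrow>
      \<exists>K. K \<lhd> G \<and> H \<subset> K \<and> cyclic_group ((G\<lparr>carrier := K\<rparr>) Mod H)"
  shows "supersolvable G"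
proof -
  \<comment> \<open>\<open>P H\<close> says that a series of the required kind reaches
    \<open>H\<close>. A maximal such \<open>H\<close> other than the whole group could be prolonged
    by \<open>ext\<close>.\<close>
  define P where "P H \<longleftrightarrow> (\<exists>m N. N 0 = {\<one>} \<and> N m = H \<and> (\<forall>i\<le>m. N i \<lhd> G) \<and>
    (\<forall>i<m. N i \<subseteq> N (Suc i) \<and> cyclic_group ((G\<lparr>carrier := N (Suc i)\<rparr>) Mod N i)))"
    for H
  have PN: "H \<lhd> G" if "P H" for H using that by (auto simp: P_def)
  have "P {\<one>}"
    unfolding P_def using one_is_normal by (intro exI[of _ 0] exI[of _ "\<lambda>_. {\<one>}"]) auto
  have "{H. P H} \<subseteq> Pow (carrier G)"
    using subgroup.subset[OF normal_imp_subgroup[OF PN]] by blast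
  then have "finite {H. P H}"
    by (rule finite_subset) (simp add: fin)
  from finite_has_maximal2[OF this, of "{\<one>}"] \<open>P {\<one>}\<close>
  obtain H where H: "P H" and max: "\<And>K. P K \<Longrightarrow> H \<subseteq> K \<Longrightarrow> H = K"
    by auto
  have "H = carrier G"
  proof (rule ccontr)
    assume "H \<noteq> carrier G"
    then obtain K where K: "K \<lhd> G" "H \<subset> K" "cyclic_group ((G\<lparr>carrier := K\<rparr>) Mod H)"
      using ext PN[OF H] by blast
    obtain m N where N: "N 0 = {\<one>}" "N m = H" "\<forall>i\<le>m. N i \<lhd> G"
      "\<forall>i<m. N i \<subseteq> N (Suc i) \<and> cyclic_group ((G\<lparr>carrier := N (Suc i)\<rparr>) Mod N i)"
      using H unfolding P_def by blast
    have "P K"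
      unfolding P_def using N K
      by (intro exI[of _ "Suc m"] exI[of _ "N(Suc m := K)"]) (auto simp: less_Suc_eq le_Suc_eq)
    then show False using max K(2) by blast
  qed
  then show ?thesis using H unfolding P_def supersolvable_def by simp
qed

theorem theoremA:
  fixes G :: "('a, 'b) monoid_scheme"
  assumes "group G" and "finite (carrier G)" and "max_irredundant G \<le> 6"
  shows "supersolvable G"
proof -
  interpret group G by fact
  obtain S where "S \<subseteq> cyclic_subgroups G" "\<Union>S = carrier G" "finite S" "card S \<le> 6"
    using ex_cyclic_cover assms(2,3) by blast
  then show ?thesis
    using supersolvable_if_extensions[OF assms(2)] normal.ex_normal_cyclic_extension[OF _ assms(2)]
    by blast
qed

end
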